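(* Let $\sigma\ge 0$ and $\beta\ge 0$ be constants. Then the following two modifications of the Newton method are equivalent, i.e. from the same point $x^k\in\mathbb R^d$ they produce the same next point $x^{k+1}$: (Regularization) $x^{k+1}=T_{\sigma,\beta}(x^k)$, where $$T_{\sigma,\beta}(x)=\operatorname*{argmin}_{y\in\mathbb R^d}\Big\{\Phi_x(y)+\frac{\sigma}{2+\beta}\|y-x\|_x^{2+\beta}\Big\};$$ (Damping) $x^{k+1}=x^k-\alpha_k[\nabla^2 f(x^k)]^{-1}\nabla f(x^k)$, where $\alpha_k\in(0,1]$ is the only positive root of $$P[\alpha]=1-\alpha-\alpha^{1+\beta}\,\sigma\,\big(\|\nabla f(x^k)\|_{x^k}^{*}\big)^{\beta}.$$
   Context: $f:\mathbb R^d\to\mathbb R$ is convex and twice differentiable with nondegenerate (positive definite) Hessian at every point. Local norms: $\|h\|_x=\langle\nabla^2 f(x)h,h\rangle^{1/2}$ and $\|g\|_x^*=\langle g,[\nabla^2 f(x)]^{-1}g\rangle^{1/2}$. The second-order Taylor model is $\Phi_x(y)=f(x)+\langle\nabla f(x),y-x\rangle+\frac12\|y-x\|_x^2$. *)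

theory Defs
  imports "HOL-Analysis.Analysis"
begin

definition grad :: "(real ^ 'd \<Rightarrow> real) \<Rightarrow> real ^ 'd \<Rightarrow> real ^ 'd" where
  "grad f x = (THE g. GDERIV f x :> g)"

definition hessian :: "(real ^ 'd \<Rightarrow> real) \<Rightarrow> real ^ 'd \<Rightarrow> real ^ 'd ^ 'd" where
  "hessian f x = jacobian (grad f) (at x)"

definition twice_differentiable :: "(real ^ 'd \<Rightarrow> real) \<Rightarrow> bool" where
  "twice_differentiable f \<longleftrightarrow> f differentiable_on UNIV \<and> grad f differentiable_on UNIV"

text \<open>Symmetry is not part of this definition: the Hessian of a twice (Frechet)
  differentiable function is automatically symmetric.\<close>

definition pos_def_matrix :: "real ^ 'd ^ 'd \<Rightarrow> bool" where
  "pos_def_matrix A \<longleftrightarrow> (\<forall>h. h \<noteq> 0 \<longrightarrow> 0 < (A *v h) \<bullet> h)"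

definition local_norm :: "(real ^ 'd \<Rightarrow> real) \<Rightarrow> real ^ 'd \<Rightarrow> real ^ 'd \<Rightarrow> real" where
  "local_norm f x h = sqrt ((hessian f x *v h) \<bullet> h)"

definition dual_local_norm :: "(real ^ 'd \<Rightarrow> real) \<Rightarrow> real ^ 'd \<Rightarrow> real ^ 'd \<Rightarrow> real" where
  "dual_local_norm f x g = sqrt (g \<bullet> (matrix_inv (hessian f x) *v g))"

definition taylor2 :: "(real ^ 'd \<Rightarrow> real) \<Rightarrow> real ^ 'd \<Rightarrow> real ^ 'd \<Rightarrow> real" where
  "taylor2 f x y = f x + grad f x \<bullet> (y - x) + 1 / 2 * (local_norm f x (y - x))\<^sup>2"

text \<open>Real powers of a nonnegative base with the convention that the zeroth power of zero
  is one, whereas \<^term>\<open>0 powr 0 = (0::real)\<close>.\<close>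

definition rpow :: "real \<Rightarrow> real \<Rightarrow> real" where
  "rpow a p = (if p = 0 then 1 else a powr p)"

definition regularized_model ::
    "(real ^ 'd \<Rightarrow> real) \<Rightarrow> real \<Rightarrow> real \<Rightarrow> real ^ 'd \<Rightarrow> real ^ 'd \<Rightarrow> real" where
  "regularized_model f \<sigma> \<beta> x y =
     taylor2 f x y + \<sigma> / (2 + \<beta>) * rpow (local_norm f x (y - x)) (2 + \<beta>)"

definition regularized_step ::
    "(real ^ 'd \<Rightarrow> real) \<Rightarrow> real \<Rightarrow> real \<Rightarrow> real ^ 'd \<Rightarrow> real ^ 'd" where
  "regularized_step f \<sigma> \<beta> x = (ARG_MIN (regularized_model f \<sigma> \<beta> x) y. True)"

definition damping_poly ::
    "(real ^ 'd \<Rightarrow> real) \<Rightarrow> real \<Rightarrow> real \<Rightarrow> real ^ 'd \<Rightarrow> real \<Rightarrow> real" where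
  "damping_poly f \<sigma> \<beta> x \<alpha> =
     1 - \<alpha> - rpow \<alpha> (1 + \<beta>) * \<sigma> * rpow (dual_local_norm f x (grad f x)) \<beta>"

definition damping_coeff ::
    "(real ^ 'd \<Rightarrow> real) \<Rightarrow> real \<Rightarrow> real \<Rightarrow> real ^ 'd \<Rightarrow> real" where
  "damping_coeff f \<sigma> \<beta> x = (THE \<alpha>. 0 < \<alpha> \<and> damping_poly f \<sigma> \<beta> x \<alpha> = 0)"

definition damped_step ::
    "(real ^ 'd \<Rightarrow> real) \<Rightarrow> real \<Rightarrow> real \<Rightarrow> real ^ 'd \<Rightarrow> real ^ 'd" where
  "damped_step f \<sigma> \<beta> x =
     x - damping_coeff f \<sigma> \<beta> x *\<^sub>R (matrix_inv (hessian f x) *v grad f x)"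

end

theory Submission
  imports Defs
begin

text \<open>
  Fix \<open>x\<close>, let \<open>A\<close> be the Hessian at \<open>x\<close>, \<open>n\<close> the Newton direction, i.e. \<open>A n = \<nabla>f(x)\<close>, and let
  \<open>\<langle>a, b\<rangle> = (A a) \<bullet> b\<close> and \<open>\<parallel>a\<parallel>\<close> be the inner product and norm given by \<open>A\<close>. As a function of
  \<open>h = y - x\<close> the regularized model is, up to a constant,
  \<open>m(h) = \<langle>n, h\<rangle> + \<parallel>h\<parallel>\<^sup>2 / 2 + \<sigma> \<parallel>h\<parallel>\<^sup>2\<^sup>+\<^sup>\<beta> / (2 + \<beta>)\<close>, and the dual norm of the gradient is \<open>\<parallel>n\<parallel>\<close>. Its critical points satisfy
  \<open>n + (1 + \<sigma> \<parallel>h\<parallel>\<^sup>\<beta>) h = 0\<close>; hence \<open>h = -\<alpha> n\<close>, and \<open>\<alpha> > 0\<close> gives a critical point as soon as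
  \<open>1 - \<alpha> - \<alpha>\<^sup>1\<^sup>+\<^sup>\<beta> \<sigma> \<parallel>n\<parallel>\<^sup>\<beta> = 0\<close>, which is the equation of the damping coefficient.

  No differentiation of \<open>m\<close> is required to see that this critical point \<open>h\<^sub>0\<close> is the strict
  minimizer. Convexity of \<open>r \<mapsto> r\<^sup>2\<^sup>+\<^sup>\<beta>\<close> and the Cauchy-Schwarz inequality bound the power term from
  below by a function that is affine in \<open>h\<close>, and the quadratic part is expanded exactly; the linear
  terms then cancel by the critical point equation, leaving \<open>m(h) \<ge> m(h\<^sub>0) + \<parallel>h - h\<^sub>0\<parallel>\<^sup>2 / 2\<close>
  (lemma \<open>regularized_quadratic_growth\<close>).

  All of this needs \<open>A\<close> to be symmetric: otherwise the quadratic part sees only the symmetric part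
  of \<open>A\<close>, while the Newton direction depends on all of it. Since \<open>\<nabla>f\<close> is only assumed to be
  differentiable, without continuity of its derivative, symmetry is proved by comparing two
  mean value expansions of the same second difference (lemma \<open>gradient_derivative_symmetric\<close>).
\<close>

section \<open>Symmetry of the second derivative\<close>

text \<open>
  The mean value theorem is applied only to the increment of \<open>f\<close> in direction \<open>v\<close>, viewed as a
  function along \<open>u\<close>. Its derivative is a difference of two gradients near \<open>x\<close>, and both are
  expanded at the base point \<open>x\<close>, so that differentiability of the gradient at that one point is
  enough. The second difference itself is invariant under exchanging \<open>u\<close> and \<open>v\<close>, so its leading
  coefficient \<open>u \<bullet> H v\<close> must be, too.
\<close>

lemma second_difference_expansion:
  fixes f :: "'a::real_inner \<Rightarrow> real"
  assumes grad: "\<And>z. GDERIV f z :> G z"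
    and hess: "(G has_derivative H) (at x)"
    and "0 < e"
  obtains d where "0 < d"
    and "\<And>t. 0 < t \<Longrightarrow> t < d \<Longrightarrow>
      \<bar>f (x + t *\<^sub>R u + t *\<^sub>R v) - f (x + t *\<^sub>R u) - f (x + t *\<^sub>R v) + f x - t\<^sup>2 * (u \<bullet> H v)\<bar>
        \<le> e * t\<^sup>2"
proof -
  \<comment> \<open>The two remainders are at most \<open>e' t (\<parallel>u\<parallel> + \<parallel>v\<parallel>)\<close> and \<open>e' t \<parallel>u\<parallel>\<close>, and both are paired with \<open>u\<close>.\<close>
  define C where "C = norm u * (2 * norm u + norm v)"
  define e' where "e' = e / (C + 1)"
  have C: "0 \<le> C" by (simp add: C_def)
  have e': "0 < e'" "e' * C \<le> e"
    using C \<open>0 < e\<close> by (simp_all add: e'_def field_simps)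
  have lin: "linear H"
    using hess by (rule has_derivative_linear)
  obtain \<delta> where "0 < \<delta>"
    and \<delta>: "\<And>y. norm (y - x) < \<delta> \<Longrightarrow> norm (G y - G x - H (y - x)) \<le> e' * norm (y - x)"
    using hess e'(1) unfolding has_derivative_at_alt by blast
  have rem: "norm (G (x + w) - G x - H w) \<le> e' * norm w" if "norm w < \<delta>" for w
    using \<delta>[of "x + w"] that by simp
  define d where "d = \<delta> / (norm u + norm v + 1)"
  have pos: "0 < norm u + norm v + 1"
    by (smt (verit) norm_ge_zero)
  show ?thesis
  proof (rule that[of d])
    show "0 < d" using \<open>0 < \<delta>\<close> pos by (simp add: d_def)
  next
    fix t :: real assume t: "0 < t" "t < d"
    have t\<delta>: "t * (norm u + norm v) < \<delta>"
    proof -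
      have "t * (norm u + norm v + 1) < \<delta>"
        using t(2) pos by (simp add: d_def pos_less_divide_eq)
      then show ?thesis using t(1) by (simp add: algebra_simps)
    qed
    define \<phi> where "\<phi> s = f (x + s *\<^sub>R u + t *\<^sub>R v) - f (x + s *\<^sub>R u)" for s
    define \<phi>' where "\<phi>' s = u \<bullet> (G (x + s *\<^sub>R u + t *\<^sub>R v) - G (x + s *\<^sub>R u))" for s
    have line: "((\<lambda>s. f (a + s *\<^sub>R u)) has_derivative (\<lambda>r. r * (u \<bullet> G (a + s *\<^sub>R u)))) (at s)"
      for a s
    proof -
      have "((\<lambda>s. a + s *\<^sub>R u) has_derivative (\<lambda>r. r *\<^sub>R u)) (at s)"
        by (auto intro!: derivative_eq_intros)
      from has_derivative_compose[OF this grad[unfolded gderiv_def]]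
      show ?thesis by simp
    qed
    have der: "(\<phi> has_derivative (\<lambda>r. r * \<phi>' s)) (at s)" for s
      using has_derivative_diff[OF line[of "x + t *\<^sub>R v" s] line[of x s]]
      by (simp add: \<phi>_def[abs_def] \<phi>'_def inner_diff_right algebra_simps)
    have "continuous_on {0..t} \<phi>"
      using der by (intro continuous_at_imp_continuous_on ballI) (rule has_derivative_continuous)
    then obtain \<xi> where \<xi>: "0 < \<xi>" "\<xi> < t" "\<phi> t - \<phi> 0 = t * \<phi>' \<xi>"
      using mvt[OF t(1), of \<phi> "\<lambda>s r. r * \<phi>' s"] der by auto
    have nu: "norm (\<xi> *\<^sub>R u) \<le> t * norm u"
      using \<xi> by (simp add: mult_right_mono)
    have nuv: "norm (\<xi> *\<^sub>R u + t *\<^sub>R v) \<le> t * (norm u + norm v)"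
      using norm_triangle_ineq[of "\<xi> *\<^sub>R u" "t *\<^sub>R v"] nu t by (simp add: algebra_simps)
    have "t * norm u \<le> t * (norm u + norm v)"
      using t by (simp add: mult_left_mono)
    then have small: "norm (\<xi> *\<^sub>R u) < \<delta>" "norm (\<xi> *\<^sub>R u + t *\<^sub>R v) < \<delta>"
      using nu nuv t\<delta> by linarith+
    define R where "R w = G (x + w) - G x - H w" for w
    have "G (x + \<xi> *\<^sub>R u + t *\<^sub>R v) - G (x + \<xi> *\<^sub>R u) - t *\<^sub>R H v
        = R (\<xi> *\<^sub>R u + t *\<^sub>R v) - R (\<xi> *\<^sub>R u)"
      by (simp add: R_def linear_add[OF lin] linear_scale[OF lin] add.assoc)
    then have "\<phi>' \<xi> - t * (u \<bullet> H v) = u \<bullet> (R (\<xi> *\<^sub>R u + t *\<^sub>R v) - R (\<xi> *\<^sub>R u))"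
      unfolding \<phi>'_def by (metis inner_diff_right inner_scaleR_right)
    also have "\<bar>\<dots>\<bar> \<le> norm u * norm (R (\<xi> *\<^sub>R u + t *\<^sub>R v) - R (\<xi> *\<^sub>R u))"
      by (rule Cauchy_Schwarz_ineq2)
    also have "\<dots> \<le> norm u * (e' * (t * (norm u + norm v)) + e' * (t * norm u))"
    proof (rule mult_left_mono)
      have "norm (R (\<xi> *\<^sub>R u + t *\<^sub>R v)) \<le> e' * (t * (norm u + norm v))"
        using rem[OF small(2)] nuv e'(1) unfolding R_def
        by (meson mult_left_mono less_imp_le order_trans)
      moreover have "norm (R (\<xi> *\<^sub>R u)) \<le> e' * (t * norm u)"
        using rem[OF small(1)] nu e'(1) unfolding R_def
        by (meson mult_left_mono less_imp_le order_trans)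
      ultimately show "norm (R (\<xi> *\<^sub>R u + t *\<^sub>R v) - R (\<xi> *\<^sub>R u))
          \<le> e' * (t * (norm u + norm v)) + e' * (t * norm u)"
        by (smt (verit) norm_triangle_ineq4)
    qed simp
    also have "\<dots> = t * (e' * C)"
      by (simp add: C_def algebra_simps)
    also have "\<dots> \<le> t * e"
      using e'(2) t by (simp add: mult_left_mono)
    finally have main: "\<bar>\<phi>' \<xi> - t * (u \<bullet> H v)\<bar> \<le> t * e" .
    have "\<phi> t - \<phi> 0 - t\<^sup>2 * (u \<bullet> H v) = t * (\<phi>' \<xi> - t * (u \<bullet> H v))"
      using \<xi>(3) by (simp add: power2_eq_square algebra_simps)
    then have "\<bar>\<phi> t - \<phi> 0 - t\<^sup>2 * (u \<bullet> H v)\<bar> \<le> t * (t * e)"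
      using main t by (simp add: abs_mult mult_left_mono)
    then show "\<bar>f (x + t *\<^sub>R u + t *\<^sub>R v) - f (x + t *\<^sub>R u) - f (x + t *\<^sub>R v) + f x
        - t\<^sup>2 * (u \<bullet> H v)\<bar> \<le> e * t\<^sup>2"
      by (simp add: \<phi>_def power2_eq_square algebra_simps)
  qed
qed

lemma gradient_derivative_symmetric:
  fixes f :: "'a::real_inner \<Rightarrow> real"
  assumes grad: "\<And>z. GDERIV f z :> G z"
    and hess: "(G has_derivative H) (at x)"
  shows "u \<bullet> H v = v \<bullet> H u"
proof -
  have "\<bar>u \<bullet> H v - v \<bullet> H u\<bar> \<le> 2 * e" if "0 < e" for e :: real
  proof -
    define D where
      "D t = f (x + t *\<^sub>R u + t *\<^sub>R v) - f (x + t *\<^sub>R u) - f (x + t *\<^sub>R v) + f x" for t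
    obtain d1 where d1: "0 < d1" "\<And>t. 0 < t \<Longrightarrow> t < d1 \<Longrightarrow> \<bar>D t - t\<^sup>2 * (u \<bullet> H v)\<bar> \<le> e * t\<^sup>2"
      using second_difference_expansion[OF grad hess \<open>0 < e\<close>, of u v] unfolding D_def by metis
    have swap: "f (x + t *\<^sub>R v + t *\<^sub>R u) - f (x + t *\<^sub>R v) - f (x + t *\<^sub>R u) + f x = D t" for t
      by (simp add: D_def add.assoc add.commute[of "t *\<^sub>R u"])
    obtain d2 where d2: "0 < d2" "\<And>t. 0 < t \<Longrightarrow> t < d2 \<Longrightarrow> \<bar>D t - t\<^sup>2 * (v \<bullet> H u)\<bar> \<le> e * t\<^sup>2"
      using second_difference_expansion[OF grad hess \<open>0 < e\<close>, of v u] unfolding swap by metis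
    obtain t where t: "0 < t" "t < d1" "t < d2"
      using field_lbound_gt_zero[OF d1(1) d2(1)] by blast
    have "t\<^sup>2 * \<bar>u \<bullet> H v - v \<bullet> H u\<bar> = \<bar>t\<^sup>2 * (u \<bullet> H v) - t\<^sup>2 * (v \<bullet> H u)\<bar>"
      by (metis abs_mult abs_power2 right_diff_distrib)
    also have "\<dots> \<le> t\<^sup>2 * (2 * e)"
      using d1(2)[OF t(1,2)] d2(2)[OF t(1,3)] by (simp add: mult.commute[of e])
    finally show ?thesis
      using t(1) by simp
  qed
  from this[of "\<bar>u \<bullet> H v - v \<bullet> H u\<bar> / 4"] show ?thesis
    by (cases "u \<bullet> H v = v \<bullet> H u") simp_all
qed

lemma GDERIV_grad:
  fixes f :: "real ^ 'd \<Rightarrow> real"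
  assumes "f differentiable (at x)"
  shows "GDERIV f x :> grad f x"
proof -
  obtain f' where f': "(f has_derivative f') (at x)"
    using assms by (auto simp: differentiable_def)
  have "f' h = h \<bullet> adjoint f' 1" for h
    using adjoint_works[OF has_derivative_linear[OF f'], of h 1] by (simp add: inner_commute)
  then have g: "GDERIV f x :> adjoint f' 1"
    using f' unfolding gderiv_def by (metis (no_types, lifting) ext)
  moreover have "D = adjoint f' 1" if "GDERIV f x :> D" for D
    using has_derivative_unique[OF that[unfolded gderiv_def] g[unfolded gderiv_def]]
    by (metis vector_eq_ldot)
  ultimately show ?thesis
    unfolding grad_def by (rule theI)
qed

lemma hessian_symmetric:
  fixes f :: "real ^ 'd \<Rightarrow> real"
  assumes "twice_differentiable f"
  shows "(hessian f x *v a) \<bullet> b = (hessian f x *v b) \<bullet> a"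
proof -
  have "GDERIV f z :> grad f z" for z
    using assms by (simp add: GDERIV_grad twice_differentiable_def differentiable_on_def)
  moreover have "(grad f has_derivative (\<lambda>h. hessian f x *v h)) (at x)"
    using assms unfolding hessian_def
    by (simp add: twice_differentiable_def differentiable_on_def flip: jacobian_works)
  ultimately show ?thesis
    by (metis gradient_derivative_symmetric inner_commute)
qed

section \<open>Minimizing a regularized quadratic\<close>

lemma matrix_inv_pos_def:
  fixes A :: "real ^ 'd ^ 'd"
  assumes "pos_def_matrix A"
  shows "A *v (matrix_inv A *v g) = g"
proof -
  have "x = 0" if "A *v x = 0" for x
    using assms that unfolding pos_def_matrix_def by force
  then obtain B where "B ** A = mat 1"
    using matrix_left_invertible_ker[of A] by blast
  then have "\<exists>B. A ** B = mat 1 \<and> B ** A = mat 1"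
    using matrix_left_right_inverse[of A B] by blast
  then have "A ** matrix_inv A = mat 1"
    unfolding matrix_inv_def by (rule someI2_ex) blast
  then show ?thesis
    by (simp add: matrix_vector_mul_assoc)
qed

lemma pos_def_Cauchy_Schwarz:
  fixes A :: "real ^ 'd ^ 'd"
  assumes sym: "\<And>a b. (A *v a) \<bullet> b = (A *v b) \<bullet> a"
    and pd: "pos_def_matrix A"
  shows "(A *v a) \<bullet> b \<le> sqrt ((A *v a) \<bullet> a) * sqrt ((A *v b) \<bullet> b)"
proof (cases "a = 0 \<or> b = 0")
  case True
  then show ?thesis by auto
next
  case False
  define r s where "r = sqrt ((A *v a) \<bullet> a)" and "s = sqrt ((A *v b) \<bullet> b)"
  have rs: "0 < r" "0 < s" "(A *v a) \<bullet> a = r\<^sup>2" "(A *v b) \<bullet> b = s\<^sup>2"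
    using False pd by (auto simp: pos_def_matrix_def r_def s_def less_imp_le)
  have "0 \<le> (A *v (s *\<^sub>R a - r *\<^sub>R b)) \<bullet> (s *\<^sub>R a - r *\<^sub>R b)"
    using pd unfolding pos_def_matrix_def by (metis inner_zero_right less_imp_le order_refl)
  also have "\<dots> = s\<^sup>2 * ((A *v a) \<bullet> a) - 2 * (r * s) * ((A *v a) \<bullet> b) + r\<^sup>2 * ((A *v b) \<bullet> b)"
    using sym[of b a]
    by (simp add: matrix_vector_mult_diff_distrib matrix_vector_mult_scaleR inner_diff_left
        inner_diff_right power2_eq_square algebra_simps)
  also have "\<dots> = 2 * (r * s) * (r * s - (A *v a) \<bullet> b)"
    by (simp add: rs power2_eq_square algebra_simps)
  finally show ?thesis
    using rs(1,2) by (simp add: zero_le_mult_iff flip: r_def s_def) (smt (verit) mult_pos_pos)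
qed

text \<open>
  The tangent line inequality for \<open>r \<mapsto> r\<^sup>2\<^sup>+\<^sup>\<beta> / (2 + \<beta>)\<close> at \<open>s\<close>, read off from Young's inequality
  for \<open>r\<close> and \<open>s\<^sup>1\<^sup>+\<^sup>\<beta>\<close> with exponents \<open>2 + \<beta>\<close> and \<open>(2 + \<beta>) / (1 + \<beta>)\<close>; unlike a derivative
  argument on the open half-line, this includes \<open>r = 0\<close> and \<open>s = 0\<close>. The slope is written as \<open>s\<^sup>\<beta> \<cdot> s\<close> because a multiple of \<open>s r\<close> is what
  Cauchy-Schwarz bounds from below.
\<close>

lemma rpow_tangent_le:
  assumes "0 \<le> \<beta>" "0 \<le> r" "0 \<le> s"
  shows "rpow s (2 + \<beta>) / (2 + \<beta>) + rpow s \<beta> * (s * r - s\<^sup>2) \<le> rpow r (2 + \<beta>) / (2 + \<beta>)"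
proof -
  define p q where "p = 2 + \<beta>" and "q = (2 + \<beta>) / (1 + \<beta>)"
  have split1: "rpow s \<beta> * s = s powr (1 + \<beta>)"
    using assms by (cases "s = 0") (auto simp: rpow_def powr_add)
  have split2: "rpow s \<beta> * s\<^sup>2 = s powr p"
    using assms by (cases "s = 0") (auto simp: rpow_def p_def powr_add)
  have "r * s powr (1 + \<beta>) \<le> r powr p / p + (s powr (1 + \<beta>)) powr q / q"
    using assms by (intro Youngs_inequality) (auto simp: p_def q_def field_simps)
  also have "(s powr (1 + \<beta>)) powr q / q = s powr p - s powr p / p"
  proof -
    have "(1 + \<beta>) * q = p" "1 / q = 1 - 1 / p"
      using assms by (simp_all add: p_def q_def field_simps)
    moreover have "s powr p / q = s powr p * (1 / q)" by simp
    ultimately show ?thesis by (simp add: powr_powr right_diff_distrib del: divide_inverse)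
  qed
  finally have "r * s powr (1 + \<beta>) \<le> r powr p / p + (s powr p - s powr p / p)" .
  moreover have "rpow s \<beta> * (s * r - s\<^sup>2) = r * s powr (1 + \<beta>) - s powr p"
    by (simp add: split2 right_diff_distrib flip: split1)
  moreover have "rpow s (2 + \<beta>) = s powr p" "rpow r (2 + \<beta>) = r powr p"
    using assms by (auto simp: rpow_def p_def)
  ultimately show ?thesis by (simp add: p_def)
qed

text \<open>
  The hypothesis \<open>crit\<close> says that the gradient of the model, which is \<open>A\<close> applied to the
  left-hand side, vanishes at \<open>h\<^sub>0\<close>. The power term is linearized at \<open>\<parallel>h\<^sub>0\<parallel>\<close> by \<open>rpow_tangent_le\<close>, and then \<open>\<parallel>h\<^sub>0\<parallel> \<parallel>h\<parallel>\<close> is bounded below by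
  the inner product, which produces an affine minorant with the right slope at \<open>h\<^sub>0\<close>. The growth
  term is the remainder of the quadratic part, so it yields existence and uniqueness of the
  minimizer at once.
\<close>

lemma regularized_quadratic_growth:
  fixes A :: "real ^ 'd ^ 'd" and n h0 h :: "real ^ 'd" and \<sigma> \<beta> :: real
  defines "N \<equiv> \<lambda>a. sqrt ((A *v a) \<bullet> a)"
  defines "m \<equiv> \<lambda>a. (A *v n) \<bullet> a + 1 / 2 * (N a)\<^sup>2 + \<sigma> / (2 + \<beta>) * rpow (N a) (2 + \<beta>)"
  assumes sym: "\<And>a b. (A *v a) \<bullet> b = (A *v b) \<bullet> a"
    and pd: "pos_def_matrix A"
    and nonneg: "0 \<le> \<sigma>" "0 \<le> \<beta>"
    and crit: "n + (1 + \<sigma> * rpow (N h0) \<beta>) *\<^sub>R h0 = 0"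
  shows "m h0 + 1 / 2 * (N (h - h0))\<^sup>2 \<le> m h"
proof -
  have psd: "0 \<le> (A *v a) \<bullet> a" for a
    using pd unfolding pos_def_matrix_def by (metis inner_zero_right less_imp_le order_refl)
  have N: "0 \<le> N a" "(N a)\<^sup>2 = (A *v a) \<bullet> a" for a
    using psd[of a] by (simp_all add: N_def)
  define c where "c = rpow (N h0) \<beta>"
  have c: "0 \<le> c" by (simp add: c_def rpow_def)
  have cs: "(A *v h0) \<bullet> h \<le> N h0 * N h"
    unfolding N_def by (rule pos_def_Cauchy_Schwarz[OF sym pd])
  have "rpow (N h0) (2 + \<beta>) / (2 + \<beta>) + c * ((A *v h0) \<bullet> h - (N h0)\<^sup>2)
      \<le> rpow (N h0) (2 + \<beta>) / (2 + \<beta>) + c * (N h0 * N h - (N h0)\<^sup>2)"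
    using cs c by (simp add: mult_left_mono)
  also have "\<dots> \<le> rpow (N h) (2 + \<beta>) / (2 + \<beta>)"
    unfolding c_def using rpow_tangent_le nonneg N(1) by blast
  finally have pow: "\<sigma> / (2 + \<beta>) * rpow (N h0) (2 + \<beta>) + \<sigma> * c * ((A *v h0) \<bullet> h - (N h0)\<^sup>2)
      \<le> \<sigma> / (2 + \<beta>) * rpow (N h) (2 + \<beta>)"
    using mult_left_mono[OF _ nonneg(1)] by (fastforce simp: algebra_simps)
  have quad: "(N h)\<^sup>2 = (N h0)\<^sup>2 + 2 * ((A *v h0) \<bullet> h - (N h0)\<^sup>2) + (N (h - h0))\<^sup>2"
    using sym[of h h0]
    by (simp add: N(2) matrix_vector_mult_diff_distrib inner_diff_left inner_diff_right)
  have n: "n = - ((1 + \<sigma> * c) *\<^sub>R h0)"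
    using crit by (simp add: c_def eq_neg_iff_add_eq_0)
  have lin: "(A *v n) \<bullet> a = - ((1 + \<sigma> * c) * ((A *v h0) \<bullet> a))" for a
  proof -
    have "(A *v n) \<bullet> a = (A *v a) \<bullet> n" by (rule sym)
    also have "\<dots> = - ((1 + \<sigma> * c) * ((A *v a) \<bullet> h0))" by (simp add: n)
    finally show ?thesis by (simp only: sym[of h0 a])
  qed
  have "(A *v n) \<bullet> h - (A *v n) \<bullet> h0 = - ((1 + \<sigma> * c) * ((A *v h0) \<bullet> h - (N h0)\<^sup>2))"
    by (simp add: lin N(2) algebra_simps)
  with pow quad show ?thesis
    by (simp add: m_def algebra_simps)
qed

section \<open>The damping equation\<close>

lemma damping_equation_ex1:
  fixes c \<beta> :: real
  assumes "0 \<le> c" "0 \<le> \<beta>"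
  shows "\<exists>!\<alpha>. 0 < \<alpha> \<and> 1 - \<alpha> - rpow \<alpha> (1 + \<beta>) * c = 0"
proof -
  define P where "P \<alpha> = 1 - \<alpha> - \<alpha> powr (1 + \<beta>) * c" for \<alpha>
  have P: "1 - \<alpha> - rpow \<alpha> (1 + \<beta>) * c = P \<alpha>" for \<alpha>
    using assms by (simp add: rpow_def P_def)
  have decr: "P b < P a" if "0 < a" "a < b" for a b
  proof -
    have "a powr (1 + \<beta>) * c \<le> b powr (1 + \<beta>) * c"
      using assms that by (intro mult_right_mono powr_mono2) auto
    then show ?thesis using that by (simp add: P_def)
  qed
  have "continuous_on {0..1} P"
    unfolding P_def using assms by (intro continuous_intros continuous_on_powr') auto
  moreover have "P 0 = 1" "P 1 \<le> 0"
    using assms by (simp_all add: P_def)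
  ultimately obtain \<alpha> where "0 \<le> \<alpha>" "P \<alpha> = 0"
    using IVT2'[of P 1 0 0] by auto
  moreover from this \<open>P 0 = 1\<close> have "0 < \<alpha>"
    by (cases "\<alpha> = 0") auto
  ultimately show ?thesis
    unfolding P using decr by (metis less_irrefl linorder_neqE_linordered_idom)
qed

section \<open>Equivalence of regularization and damping\<close>

theorem theorem1:
  fixes f :: "real ^ 'd \<Rightarrow> real" and \<sigma> \<beta> :: real
  assumes "convex_on UNIV f"
    and "twice_differentiable f"
    and "\<forall>x. pos_def_matrix (hessian f x)"
    and "0 \<le> \<sigma>" and "0 \<le> \<beta>"
  shows "\<forall>x. (\<exists>!y. is_arg_min (regularized_model f \<sigma> \<beta> x) (\<lambda>_. True) y)
           \<and> (\<exists>!\<alpha>. 0 < \<alpha> \<and> damping_poly f \<sigma> \<beta> x \<alpha> = 0)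
           \<and> damping_coeff f \<sigma> \<beta> x \<in> {0<..1}
           \<and> regularized_step f \<sigma> \<beta> x = damped_step f \<sigma> \<beta> x"
proof
  fix x
  define A where "A = hessian f x"
  define N where "N = local_norm f x"
  define n where "n = matrix_inv A *v grad f x"
  define \<alpha> where "\<alpha> = damping_coeff f \<sigma> \<beta> x"
  define h0 where "h0 = - (\<alpha> *\<^sub>R n)"
  have sym: "(A *v a) \<bullet> b = (A *v b) \<bullet> a" for a b
    unfolding A_def by (rule hessian_symmetric[OF assms(2)])
  have pd: "pos_def_matrix A"
    using assms(3) by (simp add: A_def)
  have An: "A *v n = grad f x"
    unfolding n_def by (rule matrix_inv_pos_def[OF pd])
  have N_eq: "N h = sqrt ((A *v h) \<bullet> h)" for h
    by (simp add: N_def local_norm_def A_def)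
  have dual: "dual_local_norm f x (grad f x) = N n"
    by (simp add: dual_local_norm_def N_eq An flip: A_def n_def)

  have poly: "damping_poly f \<sigma> \<beta> x a = 1 - a - rpow a (1 + \<beta>) * (\<sigma> * rpow (N n) \<beta>)" for a
    by (simp add: damping_poly_def dual mult.assoc)
  have c: "0 \<le> \<sigma> * rpow (N n) \<beta>"
    using assms(4) by (simp add: rpow_def)
  have ex1: "\<exists>!\<alpha>. 0 < \<alpha> \<and> damping_poly f \<sigma> \<beta> x \<alpha> = 0"
    unfolding poly by (rule damping_equation_ex1[OF c assms(5)])
  then have root: "0 < \<alpha>" "damping_poly f \<sigma> \<beta> x \<alpha> = 0"
    unfolding \<alpha>_def damping_coeff_def using theI'[OF ex1] by blast+
  have "0 \<le> rpow \<alpha> (1 + \<beta>) * (\<sigma> * rpow (N n) \<beta>)"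
    using c by (simp add: rpow_def)
  then have "\<alpha> \<le> 1"
    using root(2) unfolding poly by linarith

  have Nh0: "N h0 = \<alpha> * N n"
    using root(1)
    by (simp add: N_eq h0_def matrix_vector_mult_scaleR real_sqrt_mult sym[of "- _"]
        flip: scaleR_minus_left)
  have Nn: "0 \<le> N n"
    using pd unfolding N_eq pos_def_matrix_def
    by (metis inner_zero_right less_imp_le order_refl real_sqrt_ge_zero)
  \<comment> \<open>Valid also for \<open>n = 0\<close> and \<open>\<beta> = 0\<close>: both zeroth powers are one by the convention of \<open>rpow\<close>.\<close>
  have "\<alpha> * rpow (N h0) \<beta> = rpow \<alpha> (1 + \<beta>) * rpow (N n) \<beta>"
    using root(1) assms(5) Nn by (simp add: Nh0 rpow_def powr_mult powr_add)
  then have "1 - (1 + \<sigma> * rpow (N h0) \<beta>) * \<alpha> = 0"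
    using root(2) unfolding poly by algebra
  moreover have "n + (1 + \<sigma> * rpow (N h0) \<beta>) *\<^sub>R h0 = (1 - (1 + \<sigma> * rpow (N h0) \<beta>) * \<alpha>) *\<^sub>R n"
    by (simp add: h0_def algebra_simps)
  ultimately have crit: "n + (1 + \<sigma> * rpow (N h0) \<beta>) *\<^sub>R h0 = 0"
    by simp

  let ?m = "regularized_model f \<sigma> \<beta> x"
  have model: "?m y = f x + ((A *v n) \<bullet> (y - x) + 1 / 2 * (N (y - x))\<^sup>2
      + \<sigma> / (2 + \<beta>) * rpow (N (y - x)) (2 + \<beta>))" for y
    by (simp add: regularized_model_def taylor2_def An N_def)
  have growth: "?m (x + h0) + 1 / 2 * (N (y - (x + h0)))\<^sup>2 \<le> ?m y" for y
    using regularized_quadratic_growth[OF sym pd assms(4,5) crit[unfolded N_eq], of "y - x"]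
    unfolding model N_eq by (simp add: diff_diff_eq)
  have "?m (x + h0) \<le> ?m y" for y
    by (rule order_trans[OF _ growth]) simp
  then have min: "is_arg_min ?m (\<lambda>_. True) (x + h0)"
    by (simp add: is_arg_min_linorder)
  have uniq: "y = x + h0" if "is_arg_min ?m (\<lambda>_. True) y" for y
  proof (rule ccontr)
    assume "y \<noteq> x + h0"
    then have "0 < N (y - (x + h0))"
      using pd unfolding N_eq pos_def_matrix_def by simp
    then have "0 < (N (y - (x + h0)))\<^sup>2" by simp
    with growth[of y] have "?m (x + h0) < ?m y" by linarith
    then show False using that by (simp add: is_arg_min_def)
  qed
  have "regularized_step f \<sigma> \<beta> x = x + h0"
    unfolding regularized_step_def arg_min_def using min uniq by (rule some_equality)
  moreover have "damped_step f \<sigma> \<beta> x = x + h0"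
    by (simp add: damped_step_def h0_def \<alpha>_def n_def A_def)
  ultimately have "regularized_step f \<sigma> \<beta> x = damped_step f \<sigma> \<beta> x"
    by simp
  moreover have "damping_coeff f \<sigma> \<beta> x \<in> {0<..1}"
    using root(1) \<open>\<alpha> \<le> 1\<close> by (simp add: \<alpha>_def)
  moreover have "\<exists>!y. is_arg_min ?m (\<lambda>_. True) y"
    using min uniq by (rule ex1I)
  ultimately show "(\<exists>!y. is_arg_min ?m (\<lambda>_. True) y)
           \<and> (\<exists>!\<alpha>. 0 < \<alpha> \<and> damping_poly f \<sigma> \<beta> x \<alpha> = 0)
           \<and> damping_coeff f \<sigma> \<beta> x \<in> {0<..1}
           \<and> regularized_step f \<sigma> \<beta> x = damped_step f \<sigma> \<beta> x"
    using ex1 by blast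
qed

end
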